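(* Let $S=K[x_1,\dots,x_n]$ be a standard graded polynomial ring over a field $K$ and let $I\subset S$ be a nonzero proper monomial ideal. Then $$\mathrm{v}_{\mathfrak p}(I)\ \ge\ \alpha(I)-1\quad\text{for all } \mathfrak p\in\mathrm{Ass}(I).$$ In particular, $\mathrm{v}(I^k)\ge \alpha(I)k-1$ for all $k\ge 1$.
   Context: $S=\bigoplus_{d\ge0}S_d$ with $\deg x_i=1$. For a graded ideal $I\subset S$: $\mathrm{Ass}(I)$ denotes the set of associated primes of $S/I$; $\alpha(I)=\min\{d: I_d\neq 0\}$ is the initial degree. For $\mathfrak p\in\mathrm{Ass}(I)$, the v-number of $I$ at $\mathfrak p$ is $\mathrm{v}_{\mathfrak p}(I)=\min\{d: \text{there exists } f\in S_d \text{ with } (I:f)=\mathfrak p\}$, and the v-number of $I$ is $\mathrm{v}(I)=\min\{d: \text{there exists } f\in S_d\text{ with } (I:f)\in\mathrm{Ass}(I)\}$. *)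

theory Defs
  imports "HOL-Library.Poly_Mapping" "HOL-Algebra.Algebra" "HOL-Algebra.Algebraic_Closure_Type"
begin

section \<open>Associated primes and colon ideals\<close>

definition colon :: "('a, 'b) ring_scheme \<Rightarrow> 'a set \<Rightarrow> 'a \<Rightarrow> 'a set" where
  "colon R I f = {g \<in> carrier R. g \<otimes>\<^bsub>R\<^esub> f \<in> I}"

text \<open>The associated primes of the \<open>R\<close>-module \<open>R/I\<close>: the prime ideals of \<open>R\<close> that are
  annihilators of an element of \<open>R/I\<close>; \<open>r\<close> acts on \<open>R/I\<close> as multiplication by its class.\<close>

definition Ass :: "('a, 'b) ring_scheme \<Rightarrow> 'a set \<Rightarrow> 'a set set" where
  "Ass R I = {P. primeideal P R \<and>
     (\<exists>x \<in> carrier (R Quot I).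
        P = {r \<in> carrier R. (I +>\<^bsub>R\<^esub> r) \<otimes>\<^bsub>R Quot I\<^esub> x = \<zero>\<^bsub>R Quot I\<^esub>})}"

lemma Ass_eq_colon:
  assumes "ideal I R"
  shows "Ass R I = {P. primeideal P R \<and> (\<exists>f \<in> carrier R. P = colon R I f)}"
proof -
  interpret ideal I R by fact
  have carr: "carrier (R Quot I) = {I +>\<^bsub>R\<^esub> f | f. f \<in> carrier R}"
    by (auto simp: FactRing_def A_RCOSETS_def')
  have "{r \<in> carrier R. (I +>\<^bsub>R\<^esub> r) \<otimes>\<^bsub>R Quot I\<^esub> (I +>\<^bsub>R\<^esub> f) = \<zero>\<^bsub>R Quot I\<^esub>} = colon R I f"
    if f: "f \<in> carrier R" for f
  proof -
    have "I +>\<^bsub>R\<^esub> (r \<otimes>\<^bsub>R\<^esub> f) = I \<longleftrightarrow> r \<otimes>\<^bsub>R\<^esub> f \<in> I" if "r \<in> carrier R" for r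
      using that f a_coset_join1 a_coset_join2 a_rcos_const
      by (metis a_rcos_self m_closed)
    moreover have "(I +>\<^bsub>R\<^esub> r) \<otimes>\<^bsub>R Quot I\<^esub> (I +>\<^bsub>R\<^esub> f) = I +>\<^bsub>R\<^esub> (r \<otimes>\<^bsub>R\<^esub> f)"
      if "r \<in> carrier R" for r
      using that f by (simp add: FactRing_def rcoset_mult_add)
    moreover have "\<zero>\<^bsub>R Quot I\<^esub> = I"
      by (simp add: FactRing_def)
    ultimately show ?thesis
      unfolding colon_def by (intro Collect_cong conj_cong refl) simp
  qed
  then show ?thesis
    unfolding Ass_def carr by blast
qed


section \<open>The standard graded polynomial ring\<close>

text \<open>\<open>K[x\<^sub>1, \<dots>, x\<^sub>n]\<close> is the monoid algebra of the exponent vectors \<open>'n \<Rightarrow>\<^sub>0 nat\<close>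
  over the field \<open>'k\<close>, where the variables are indexed by the finite type \<open>'n\<close>,
  i.e. \<open>n = CARD('n)\<close>.\<close>

type_synonym ('n, 'k) mpoly = "('n \<Rightarrow>\<^sub>0 nat) \<Rightarrow>\<^sub>0 'k"

abbreviation S :: "('n::finite, 'k::field) mpoly ring" where
  "S \<equiv> ring_of_type_algebra"

definition exp_degree :: "('n::finite \<Rightarrow>\<^sub>0 nat) \<Rightarrow> nat" where
  "exp_degree m = (\<Sum>i\<in>UNIV. Poly_Mapping.lookup m i)"

definition graded_part :: "nat \<Rightarrow> ('n::finite, 'k::field) mpoly set" where
  "graded_part d = {f. \<forall>m \<in> Poly_Mapping.keys f. exp_degree m = d}"

definition monomial_ideal :: "('n::finite, 'k::field) mpoly set \<Rightarrow> bool" where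
  "monomial_ideal I \<longleftrightarrow> (\<exists>M. I = Idl\<^bsub>S\<^esub> ((\<lambda>m. Poly_Mapping.single m 1) ` M))"


section \<open>Initial degree and v-numbers\<close>

text \<open>The minima below are only meaningful when they are attained: for \<open>initial_degree I\<close> if
  \<open>I\<close> is a nonzero graded ideal, for \<open>v_number_at I P\<close> if in addition \<open>P \<in> Ass S I\<close>, and
  for \<open>v_number I\<close> if \<open>I\<close> is a proper graded ideal.\<close>

definition initial_degree :: "('n::finite, 'k::field) mpoly set \<Rightarrow> nat" where
  "initial_degree I = (LEAST d. I \<inter> graded_part d \<noteq> {0})"

definition v_number_at :: "('n::finite, 'k::field) mpoly set \<Rightarrow> ('n, 'k) mpoly set \<Rightarrow> nat" where
  "v_number_at I P = (LEAST d. \<exists>f \<in> graded_part d. colon S I f = P)"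

definition v_number :: "('n::finite, 'k::field) mpoly set \<Rightarrow> nat" where
  "v_number I = (LEAST d. \<exists>f \<in> graded_part d. colon S I f \<in> Ass S I)"

end

theory Submission
  imports Defs
begin

text \<open>
  Write \<open>x\<^sup>a\<close> for the monomial with exponent vector \<open>a\<close>. A monomial ideal is the span of the
  monomials \<open>x\<^sup>a\<close> with \<open>a\<close> in some set \<open>U\<close> of exponent vectors closed under addition of arbitrary
  vectors, and both colon ideals by monomials and powers of monomial ideals are again of this form.

  \<^emph>\<open>The bound.\<close> Let \<open>f\<close> be homogeneous of degree \<open>d\<close> such that \<open>P = (I : f)\<close> is prime. Then \<open>P\<close>
  contains \<open>I\<close>, hence a monomial, hence a variable \<open>x\<^sub>i\<close>. As \<open>f \<noteq> 0\<close>, the product \<open>x\<^sub>i f\<close> is a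
  nonzero element of \<open>I\<close> of degree \<open>d + 1\<close>, so \<open>d + 1 \<ge> \<alpha>(I)\<close>
  (\<open>degree_bound_of_colon_prime\<close>). All monomials of \<open>I\<^sup>k\<close> have degree at least
  \<open>k \<alpha>(I)\<close>, so that the same argument applies to the powers.

  \<^emph>\<open>The minima are attained.\<close> The v-numbers are least elements of sets of degrees, and the bound
  says something about them only if these sets are nonempty. This needs two facts on a
  monomial ideal \<open>I\<close>.
  \<^item> Every associated prime of \<open>I\<close> has the form \<open>(I : x\<^sup>a)\<close>
    (\<open>colon_prime_eq_colon_monomial\<close>): if \<open>P = (I : f)\<close> with the number of terms of \<open>f\<close> outside
    \<open>I\<close> minimal, then \<open>P = (I : x\<^sup>a)\<close> for every such term \<open>x\<^sup>a\<close> of \<open>f\<close>.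
  \<^item> If \<open>I\<close> is proper, some \<open>(I : x\<^sup>a)\<close> is generated by variables, hence prime
    (\<open>upset_colon_coordinate_prime\<close>). The proof takes a largest coordinate subspace \<open>\<nat>\<^sup>B\<close>
    that has a translate in the complement of \<open>U\<close>.

  Products of polynomials are controlled by the fact that two nonempty finite sets \<open>A\<close>, \<open>B\<close> of
  exponent vectors contain \<open>a \<in> A\<close> and \<open>b \<in> B\<close> such that \<open>a + b\<close> has no other representation as a
  sum (\<open>unique_sum_exists\<close>); the coefficient of \<open>x\<^sup>a\<^sup>+\<^sup>b\<close> in a product is then a single product
  of coefficients.
\<close>

section \<open>Polynomials and their supports\<close>

lemma S_simps [simp]:
  "carrier S = UNIV" "monoid.mult S = (*)" "ring.add S = (+)" "\<one>\<^bsub>S\<^esub> = 1" "\<zero>\<^bsub>S\<^esub> = 0"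
  by (simp_all add: ring_of_type_algebra_def)

lemma cring_S: "cring (S :: ('n::finite, 'k::field) mpoly ring)"
  by (rule cring_from_type_algebra)

lemma ring_S: "ring (S :: ('n::finite, 'k::field) mpoly ring)"
  by (rule ring_from_type_algebra)

abbreviation mon :: "('n::finite \<Rightarrow>\<^sub>0 nat) \<Rightarrow> ('n, 'k::field) mpoly" where
  "mon a \<equiv> Poly_Mapping.single a 1"

lemma mon_add: "mon (a + b) = mon a * mon b"
  by (simp add: mult_single)

lemma ideal_S_iff:
  fixes P :: "('n::finite, 'k::field) mpoly set"
  shows "ideal P S \<longleftrightarrow> 0 \<in> P \<and> (\<forall>f\<in>P. \<forall>g\<in>P. f + g \<in> P) \<and> (\<forall>f\<in>P. \<forall>g. g * f \<in> P)"
    (is "_ \<longleftrightarrow> ?R")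
proof
  assume "ideal P S"
  then interpret ideal P "S :: ('n, 'k) mpoly ring" .
  have "0 \<in> P"
    using additive_subgroup.zero_closed[OF is_additive_subgroup] by simp
  then show ?R
    using additive_subgroup.a_closed[OF is_additive_subgroup] I_l_closed by simp
next
  assume R: ?R
  show "ideal P S"
  proof (rule idealI)
    show "ring (S :: ('n, 'k) mpoly ring)"
      by (rule ring_S)
    interpret r: ring "S :: ('n, 'k) mpoly ring"
      by (rule ring_S)
    show "subgroup P (add_monoid S)"
    proof (rule r.add.subgroupI)
      fix f assume "f \<in> P"
      then have "(-1) * f \<in> P"
        using R by blast
      moreover have "\<ominus>\<^bsub>S\<^esub> f = - f"
        by (rule r.minus_equality) simp_all
      ultimately show "\<ominus>\<^bsub>S\<^esub> f \<in> P"
        by simp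
    qed (use R in auto)
  qed (use R in \<open>auto simp: mult.commute\<close>)
qed

lemma ideal_minus_mem:
  fixes P :: "('n::finite, 'k::field) mpoly set"
  assumes "ideal P S" "f \<in> P" "g \<in> P"
  shows "f - g \<in> P"
proof -
  have "f + (-1) * g \<in> P"
    using assms unfolding ideal_S_iff by blast
  then show ?thesis
    by simp
qed

lemma ideal_mem_if_monomials_mem:
  fixes P :: "('n::finite, 'k::field) mpoly set"
  assumes P: "ideal P S" and "\<forall>m\<in>Poly_Mapping.keys f. mon m \<in> P"
  shows "f \<in> P"
  using assms(2)
proof (induction f rule: update_induct)
  case const
  then show ?case using P by (simp add: ideal_S_iff)
next
  case (update f a b)
  have eq: "Poly_Mapping.update a b f = f + Poly_Mapping.single 0 b * mon a"
    using update.hyps(1)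
    by (intro poly_mapping_eqI)
      (auto simp: mult_single lookup_add lookup_single lookup_update in_keys_iff)
  have k: "Poly_Mapping.keys (Poly_Mapping.update a b f) = insert a (Poly_Mapping.keys f)"
    using update.hyps by (simp add: keys_update)
  have "f \<in> P"
    using update.IH update.prems k by simp
  moreover have "mon a \<in> P"
    using update.prems k by simp
  ultimately show ?case
    using P unfolding eq ideal_S_iff by blast
qed

lemma unique_sum_exists:
  fixes A B :: "('n::finite \<Rightarrow>\<^sub>0 nat) set"
  assumes "finite A" "A \<noteq> {}" "finite B" "B \<noteq> {}"
  shows "\<exists>a\<in>A. \<exists>b\<in>B. \<forall>a'\<in>A. \<forall>b'\<in>B. a' + b' = a + b \<longrightarrow> a' = a \<and> b' = b"
proof -
  let ?l = "Poly_Mapping.lookup :: ('n \<Rightarrow>\<^sub>0 nat) \<Rightarrow> 'n \<Rightarrow> nat"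
  have "\<exists>a\<in>A. \<exists>b\<in>B. \<forall>a'\<in>A. \<forall>b'\<in>B. a' + b' = a + b \<longrightarrow>
      (\<forall>i\<in>J. ?l a' i = ?l a i \<and> ?l b' i = ?l b i)" if "finite J" for J
    using that assms
  proof (induction J arbitrary: A B rule: finite_induct)
    case empty
    then show ?case by auto
  next
    case (insert j J)
    \<comment> \<open>In coordinate \<open>j\<close>, a sum of two maximal entries is only a sum of maximal entries.\<close>
    define s where "s = Max ((\<lambda>a. ?l a j) ` A)"
    define t where "t = Max ((\<lambda>b. ?l b j) ` B)"
    have s: "?l a j \<le> s" if "a \<in> A" for a
      using that insert.prems unfolding s_def by simp
    have t: "?l b j \<le> t" if "b \<in> B" for b
      using that insert.prems unfolding t_def by simp
    have "s \<in> (\<lambda>a. ?l a j) ` A" "t \<in> (\<lambda>b. ?l b j) ` B"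
      unfolding s_def t_def using insert.prems by (auto intro!: Max_in)
    then have ne: "{a\<in>A. ?l a j = s} \<noteq> {}" "{b\<in>B. ?l b j = t} \<noteq> {}"
      by auto
    have "finite {a\<in>A. ?l a j = s}" "finite {b\<in>B. ?l b j = t}"
      using insert.prems by simp_all
    from insert.IH[OF this(1) ne(1) this(2) ne(2)]
    obtain a b where ab': "a \<in> {a\<in>A. ?l a j = s}" "b \<in> {b\<in>B. ?l b j = t}"
      and u: "\<forall>a'\<in>{a\<in>A. ?l a j = s}. \<forall>b'\<in>{b\<in>B. ?l b j = t}. a' + b' = a + b \<longrightarrow>
        (\<forall>i\<in>J. ?l a' i = ?l a i \<and> ?l b' i = ?l b i)"
      by blast
    have ab: "a \<in> A" "?l a j = s" "b \<in> B" "?l b j = t"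
      using ab' by simp_all
    have "\<forall>i\<in>insert j J. ?l a' i = ?l a i \<and> ?l b' i = ?l b i"
      if "a' \<in> A" "b' \<in> B" "a' + b' = a + b" for a' b'
    proof -
      have "?l a' j + ?l b' j = s + t"
        using arg_cong[OF that(3), of "\<lambda>m. ?l m j"] ab by (simp add: lookup_add)
      then have "?l a' j = s" "?l b' j = t"
        using s[OF that(1)] t[OF that(2)] by linarith+
      then have "a' \<in> {a\<in>A. ?l a j = s}" "b' \<in> {b\<in>B. ?l b j = t}"
        using that by simp_all
      then have "\<forall>i\<in>J. ?l a' i = ?l a i \<and> ?l b' i = ?l b i"
        using u that(3) by blast
      then show ?thesis
        using \<open>?l a' j = s\<close> \<open>?l b' j = t\<close> ab by simp
    qed
    then show ?case
      using ab by blast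
  qed
  from this[of UNIV] show ?thesis
    by (simp add: poly_mapping_eq_iff fun_eq_iff) meson
qed

lemma keys_minus_single_lookup:
  fixes f :: "('n::finite, 'k::field) mpoly"
  shows "Poly_Mapping.keys (f - Poly_Mapping.single a (Poly_Mapping.lookup f a))
    = Poly_Mapping.keys f - {a}"
  by (auto simp: in_keys_iff lookup_minus lookup_single when_def split: if_splits)

lemma unique_key_of_mult:
  fixes f g :: "('n::finite, 'k::field) mpoly"
  assumes "f \<noteq> 0" "g \<noteq> 0"
  obtains a b where "a \<in> Poly_Mapping.keys f" "b \<in> Poly_Mapping.keys g"
    "a + b \<in> Poly_Mapping.keys (f * g)"
proof -
  obtain a b where ab: "a \<in> Poly_Mapping.keys f" "b \<in> Poly_Mapping.keys g"
    and u: "\<And>a' b'. a' \<in> Poly_Mapping.keys f \<Longrightarrow> b' \<in> Poly_Mapping.keys g \<Longrightarrow>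
      a' + b' = a + b \<Longrightarrow> a' = a \<and> b' = b"
    using unique_sum_exists[of "Poly_Mapping.keys f" "Poly_Mapping.keys g"] assms by auto
  define s where "s = Poly_Mapping.single a (Poly_Mapping.lookup f a)"
  define t where "t = Poly_Mapping.single b (Poly_Mapping.lookup g b)"
  have ks: "Poly_Mapping.keys s = {a}" "Poly_Mapping.keys t = {b}"
    using ab by (auto simp: s_def t_def in_keys_iff)
  have kf: "Poly_Mapping.keys (f - s) = Poly_Mapping.keys f - {a}"
    "Poly_Mapping.keys (g - t) = Poly_Mapping.keys g - {b}"
    unfolding s_def t_def by (rule keys_minus_single_lookup)+
  have "f * g = s * t + (s * (g - t) + (f - s) * g)"
    by (simp add: algebra_simps)
  moreover have "a + b \<notin> Poly_Mapping.keys (s * (g - t))"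
  proof
    assume "a + b \<in> Poly_Mapping.keys (s * (g - t))"
    then obtain a' b' where "a' \<in> Poly_Mapping.keys s" "b' \<in> Poly_Mapping.keys g - {b}"
      "a + b = a' + b'"
      using keys_mult[of s "g - t"] unfolding kf by blast
    then show False
      using ks by simp
  qed
  moreover have "a + b \<notin> Poly_Mapping.keys ((f - s) * g)"
  proof
    assume "a + b \<in> Poly_Mapping.keys ((f - s) * g)"
    then obtain a' b' where "a' \<in> Poly_Mapping.keys f - {a}" "b' \<in> Poly_Mapping.keys g"
      "a' + b' = a + b"
      using keys_mult[of "f - s" g] unfolding kf by force
    then show False
      using u by blast
  qed
  moreover have "Poly_Mapping.lookup (s * t) (a + b) \<noteq> 0"
    using ab by (simp add: s_def t_def mult_single in_keys_iff)
  ultimately have "a + b \<in> Poly_Mapping.keys (f * g)"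
    by (simp add: in_keys_iff lookup_add)
  then show ?thesis
    using that ab by blast
qed

lemma mem_keys_mon_mult_iff:
  fixes f :: "('n::finite, 'k::field) mpoly"
  shows "m \<in> Poly_Mapping.keys (mon a * f) \<longleftrightarrow> (\<exists>b\<in>Poly_Mapping.keys f. m = a + b)"
proof (induction f arbitrary: m rule: update_induct)
  case const
  then show ?case by simp
next
  case (update f c d)
  have eq: "Poly_Mapping.update c d f = f + Poly_Mapping.single c d"
    using update.hyps(1)
    by (intro poly_mapping_eqI)
      (auto simp: lookup_add lookup_single lookup_update in_keys_iff)
  have k: "Poly_Mapping.keys (Poly_Mapping.update c d f) = insert c (Poly_Mapping.keys f)"
    using update.hyps by (simp add: keys_update)
  have e: "mon a * Poly_Mapping.update c d f = mon a * f + Poly_Mapping.single (a + c) d"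
    unfolding eq by (simp add: distrib_left mult_single)
  have 0: "Poly_Mapping.lookup (mon a * f) (a + c) = 0"
    using update.IH[of "a + c"] update.hyps(1) by (auto simp: in_keys_iff)
  show ?case
  proof (cases "m = a + c")
    case True
    then show ?thesis
      unfolding e k using update.hyps 0 by (auto simp: in_keys_iff lookup_add)
  next
    case False
    then have "m \<in> Poly_Mapping.keys (mon a * Poly_Mapping.update c d f) \<longleftrightarrow>
      m \<in> Poly_Mapping.keys (mon a * f)"
      unfolding e by (simp add: in_keys_iff lookup_add lookup_single)
    then show ?thesis
      using update.IH[of m] False k by auto
  qed
qed

corollary keys_mon_mult:
  fixes f :: "('n::finite, 'k::field) mpoly"
  shows "Poly_Mapping.keys (mon a * f) = (+) a ` Poly_Mapping.keys f"
  using mem_keys_mon_mult_iff[of _ a f] by blast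


section \<open>Monomial ideals and upward closed sets of exponents\<close>

definition upset :: "('n::finite \<Rightarrow>\<^sub>0 nat) set \<Rightarrow> bool" where
  "upset U \<longleftrightarrow> (\<forall>a\<in>U. \<forall>b. a + b \<in> U)"

text \<open>The \<open>K\<close>-linear span of the monomials with exponent vector in \<open>U\<close>; it is an ideal if \<open>U\<close>
  is upward closed.\<close>

definition monomial_span :: "('n::finite \<Rightarrow>\<^sub>0 nat) set \<Rightarrow> ('n, 'k::field) mpoly set" where
  "monomial_span U = {f. Poly_Mapping.keys f \<subseteq> U}"

lemma upset_addD: "upset U \<Longrightarrow> a \<in> U \<Longrightarrow> a + b \<in> U"
  by (simp add: upset_def)

lemma upset_mono:
  assumes "upset U" "a \<in> U" "\<And>i. Poly_Mapping.lookup a i \<le> Poly_Mapping.lookup b i"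
  shows "b \<in> U"
proof -
  have "b = a + (b - a)"
    using assms(3) by (intro poly_mapping_eqI) (simp add: lookup_add lookup_minus)
  then show ?thesis
    using upset_addD[OF assms(1,2)] by metis
qed

lemma mon_mem_monomial_span_iff [simp]:
  "(mon a :: ('n::finite, 'k::field) mpoly) \<in> monomial_span U \<longleftrightarrow> a \<in> U"
  by (simp add: monomial_span_def)

lemma ideal_monomial_span:
  assumes "upset U"
  shows "ideal (monomial_span U :: ('n::finite, 'k::field) mpoly set) S"
  unfolding ideal_S_iff
proof (intro conjI ballI allI)
  fix f g :: "('n, 'k) mpoly"
  assume f: "f \<in> monomial_span U"
  show "g * f \<in> monomial_span U"
    using f keys_mult[of f g] upset_addD[OF assms] unfolding monomial_span_def
    by (fastforce simp: mult.commute)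
  assume "g \<in> monomial_span U"
  then show "f + g \<in> monomial_span U"
    using f keys_add[of f g] unfolding monomial_span_def by blast
qed (simp add: monomial_span_def)

lemma upset_generated: "upset {a + b | a b. a \<in> M}"
  unfolding upset_def
proof (intro ballI allI)
  fix c d assume "c \<in> {a + b | a b. a \<in> M}"
  then obtain a b where "c = a + b" "a \<in> M"
    by blast
  then have "c + d = a + (b + d)" "a \<in> M"
    by (simp_all add: add.assoc)
  then show "c + d \<in> {a + b | a b. a \<in> M}"
    by blast
qed

lemma Idl_monomials_eq_monomial_span:
  fixes M :: "('n::finite \<Rightarrow>\<^sub>0 nat) set"
  shows "Idl\<^bsub>S\<^esub> (mon ` M) = (monomial_span {a + b | a b. a \<in> M} :: ('n, 'k::field) mpoly set)"
proof -
  interpret ring "S :: ('n, 'k) mpoly ring"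
    by (rule ring_S)
  let ?U = "{a + b | a b. a \<in> M}"
  have I: "ideal (Idl\<^bsub>S\<^esub> (mon ` M) :: ('n, 'k) mpoly set) S"
    by (rule genideal_ideal) simp
  have gen: "mon a \<in> (Idl\<^bsub>S\<^esub> (mon ` M) :: ('n, 'k) mpoly set)" if "a \<in> M" for a
    using genideal_self[of "mon ` M"] that by auto
  show ?thesis
  proof
    have "a \<in> ?U" if "a \<in> M" for a
      using that by (metis (mono_tags, lifting) add.right_neutral mem_Collect_eq)
    then show "(Idl\<^bsub>S\<^esub> (mon ` M) :: ('n, 'k) mpoly set) \<subseteq> monomial_span ?U"
      by (intro genideal_minimal ideal_monomial_span upset_generated) (auto simp del: mem_Collect_eq)
    show "monomial_span ?U \<subseteq> (Idl\<^bsub>S\<^esub> (mon ` M) :: ('n, 'k) mpoly set)"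
    proof
      fix f :: "('n, 'k) mpoly"
      assume f: "f \<in> monomial_span ?U"
      show "f \<in> Idl\<^bsub>S\<^esub> (mon ` M)"
      proof (rule ideal_mem_if_monomials_mem[OF I], rule ballI)
        fix m assume "m \<in> Poly_Mapping.keys f"
        then obtain a b where m: "m = b + a" "a \<in> M"
          using f by (auto simp: monomial_span_def add.commute)
        show "mon m \<in> (Idl\<^bsub>S\<^esub> (mon ` M) :: ('n, 'k) mpoly set)"
          using I gen[OF m(2)] unfolding m(1) mon_add ideal_S_iff by blast
      qed
    qed
  qed
qed

lemma monomial_idealE:
  fixes I :: "('n::finite, 'k::field) mpoly set"
  assumes "monomial_ideal I"
  obtains U where "upset U" "I = monomial_span U"
proof -
  obtain M where "I = Idl\<^bsub>S\<^esub> (mon ` M)"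
    using assms unfolding monomial_ideal_def by blast
  then have "I = monomial_span {a + b | a b. a \<in> M}"
    by (simp only: Idl_monomials_eq_monomial_span)
  then show ?thesis
    by (rule that[OF upset_generated])
qed

lemma ideal_prod_monomial_span:
  fixes U V :: "('n::finite \<Rightarrow>\<^sub>0 nat) set"
  assumes "upset U" "upset V"
  shows "ideal_prod S (monomial_span U) (monomial_span V)
    = (monomial_span {u + v | u v. u \<in> U \<and> v \<in> V} :: ('n, 'k::field) mpoly set)"
    (is "?L = monomial_span ?W")
proof
  interpret ring "S :: ('n, 'k) mpoly ring"
    by (rule ring_S)
  show "?L \<subseteq> monomial_span ?W"
  proof
    fix f assume "f \<in> ?L"
    then show "f \<in> monomial_span ?W"
    proof induction
      case (prod f g)
      then show ?case
        using keys_mult[of f g] unfolding monomial_span_def by fastforce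
    next
      case (sum f g)
      then show ?case
        using keys_add[of f g] unfolding monomial_span_def S_simps by blast
    qed
  qed
  have L: "ideal ?L S"
    by (intro ideal_prod_is_ideal ideal_monomial_span assms)
  show "monomial_span ?W \<subseteq> ?L"
  proof
    fix f :: "('n, 'k) mpoly"
    assume f: "f \<in> monomial_span ?W"
    show "f \<in> ?L"
    proof (rule ideal_mem_if_monomials_mem[OF L], rule ballI)
      fix m assume "m \<in> Poly_Mapping.keys f"
      then obtain u v where m: "m = u + v" "u \<in> U" "v \<in> V"
        using f by (auto simp: monomial_span_def)
      have "mon u \<otimes>\<^bsub>S\<^esub> mon v \<in> ?L"
        using m by (intro ideal_prod.prod) simp_all
      then show "mon m \<in> ?L"
        by (simp only: S_simps m(1) mon_add)
    qed
  qed
qed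

lemma exp_degree_add: "exp_degree (a + b) = exp_degree a + exp_degree b"
  by (simp add: exp_degree_def lookup_add sum.distrib)

lemma exp_degree_single [simp]: "exp_degree (Poly_Mapping.single i (c :: nat)) = c"
  by (simp add: exp_degree_def lookup_single when_def)

lemma ideal_power_monomial_span:
  fixes U :: "('n::finite \<Rightarrow>\<^sub>0 nat) set"
  assumes U: "upset U" "U \<noteq> {}" and D: "\<And>u. u \<in> U \<Longrightarrow> D \<le> exp_degree u"
  shows "\<exists>V. upset V \<and> V \<noteq> {} \<and> (k \<ge> 1 \<longrightarrow> V \<subseteq> U) \<and> (\<forall>v\<in>V. D * k \<le> exp_degree v) \<and>
    (monomial_span U :: ('n, 'k::field) mpoly set) [^]\<^bsub>ideals_set S\<^esub> k = monomial_span V"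
proof (induction k)
  case 0
  have "(monomial_span U :: ('n, 'k) mpoly set) [^]\<^bsub>ideals_set S\<^esub> (0::nat) = monomial_span UNIV"
    by (simp add: nat_pow_def ideals_set_def monomial_span_def)
  then show ?case
    by (intro exI[of _ UNIV]) (simp add: upset_def)
next
  case (Suc k)
  then obtain V where V: "upset V" "V \<noteq> {}" "\<forall>v\<in>V. D * k \<le> exp_degree v"
    and eq: "(monomial_span U :: ('n, 'k) mpoly set) [^]\<^bsub>ideals_set S\<^esub> k = monomial_span V"
    by blast
  let ?W = "{v + u | v u. v \<in> V \<and> u \<in> U}"
  have "upset ?W"
    unfolding upset_def
  proof (intro ballI allI)
    fix w b assume "w \<in> ?W"
    then obtain v u where "w = v + u" "v \<in> V" "u \<in> U"
      by blast
    then show "w + b \<in> ?W"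
      using upset_addD[OF U(1)] by (auto simp: add.assoc)
  qed
  moreover have "?W \<noteq> {}"
    using U V by blast
  moreover have "v + u \<in> U" if "u \<in> U" for u v
    using upset_addD[OF U(1) that, of v] by (simp add: add.commute)
  then have "?W \<subseteq> U"
    by blast
  moreover have "\<forall>w\<in>?W. D * Suc k \<le> exp_degree w"
    using V(3) D by (auto simp: exp_degree_add add.commute[of D] intro!: add_mono)
  moreover have "(monomial_span U :: ('n, 'k) mpoly set) [^]\<^bsub>ideals_set S\<^esub> Suc k
      = ideal_prod S (monomial_span V) (monomial_span U)"
    using eq by (simp add: nat_pow_def ideals_set_def)
  ultimately show ?case
    using ideal_prod_monomial_span[OF V(1) U(1)] by (intro exI[of _ ?W]) simp
qed

lemma initial_degree_le:
  assumes "u \<in> U"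
  shows "initial_degree (monomial_span U :: ('n::finite, 'k::field) mpoly set) \<le> exp_degree u"
proof -
  have "mon u \<in> (monomial_span U :: ('n, 'k) mpoly set) \<inter> graded_part (exp_degree u)"
    using assms by (simp add: graded_part_def)
  moreover have "(mon u :: ('n, 'k) mpoly) \<noteq> 0"
    by (metis keys_zero keys_single insert_not_empty zero_neq_one)
  ultimately show ?thesis
    unfolding initial_degree_def by (intro Least_le) blast
qed

text \<open>Modulo the span of \<open>U\<close>, the terms with exponent in \<open>U\<close> can be dropped.\<close>

lemma reduce_modulo_monomial_span:
  fixes f :: "('n::finite, 'k::field) mpoly"
  obtains f' where "Poly_Mapping.keys f' = Poly_Mapping.keys f - U" "f - f' \<in> monomial_span U"
proof
  let ?f = "Poly_Mapping.mapp (\<lambda>m c. c when m \<notin> U) f"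
  show "Poly_Mapping.keys ?f = Poly_Mapping.keys f - U"
    by (auto simp: in_keys_iff lookup_mapp when_def)
  show "f - ?f \<in> monomial_span U"
    by (auto simp: monomial_span_def in_keys_iff lookup_minus lookup_mapp when_def split: if_splits)
qed


section \<open>Colon ideals\<close>

lemma mem_colon_S_iff [simp]: "g \<in> colon S I f \<longleftrightarrow> g * f \<in> I"
  by (simp add: colon_def)

lemma colon_monomial_span_mon:
  "colon S (monomial_span U) (mon a) =
    (monomial_span {b. a + b \<in> U} :: ('n::finite, 'k::field) mpoly set)"
proof (intro Set.set_eqI)
  fix g :: "('n, 'k) mpoly"
  show "g \<in> colon S (monomial_span U) (mon a) \<longleftrightarrow> g \<in> monomial_span {b. a + b \<in> U}"
    unfolding mem_colon_S_iff mult.commute[of g] by (auto simp: monomial_span_def keys_mon_mult)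
qed

lemma colon_cong:
  fixes I :: "('n::finite, 'k::field) mpoly set"
  assumes "ideal I S" "f - f' \<in> I"
  shows "colon S I f = colon S I f'"
proof (intro Set.set_eqI)
  fix g
  have d: "g * (f - f') \<in> I"
    using assms unfolding ideal_S_iff by blast
  have "g * f = g * f' + g * (f - f')" "g * f' = g * f - g * (f - f')"
    by (simp_all add: algebra_simps)
  then show "g \<in> colon S I f \<longleftrightarrow> g \<in> colon S I f'"
    unfolding mem_colon_S_iff
    using d ideal_minus_mem[OF assms(1), of "g * f" "g * (f - f')"] assms(1)
    unfolding ideal_S_iff by metis
qed

lemma primeideal_S_D:
  fixes P :: "('n::finite, 'k::field) mpoly set"
  assumes "primeideal P S"
  shows "ideal P S" "P \<noteq> UNIV" "1 \<notin> P" "f * g \<in> P \<Longrightarrow> f \<in> P \<or> g \<in> P"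
proof -
  interpret primeideal P "S :: ('n, 'k) mpoly ring"
    by fact
  show P: "ideal P S"
    by (rule is_ideal)
  show ne: "P \<noteq> UNIV"
    using I_notcarr by simp
  show "1 \<notin> P"
  proof
    assume "1 \<in> P"
    then have "g * 1 \<in> P" for g
      using P unfolding ideal_S_iff by blast
    then show False
      using ne by auto
  qed
  show "f * g \<in> P \<Longrightarrow> f \<in> P \<or> g \<in> P"
    using I_prime by simp
qed

lemma primeideal_monomial_span:
  assumes W: "upset W" "0 \<notin> W" "\<And>a b. a + b \<in> W \<Longrightarrow> a \<in> W \<or> b \<in> W"
  shows "primeideal (monomial_span W :: ('n::finite, 'k::field) mpoly set) S"
proof (rule primeidealI)
  let ?P = "monomial_span W :: ('n, 'k) mpoly set"
  show P: "ideal ?P S"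
    by (rule ideal_monomial_span[OF W(1)])
  show "cring (S :: ('n, 'k) mpoly ring)"
    by (rule cring_S)
  have "(mon 0 :: ('n, 'k) mpoly) \<notin> ?P"
    unfolding mon_mem_monomial_span_iff by (rule W(2))
  then show "carrier S \<noteq> ?P"
    by auto
  fix f g :: "('n, 'k) mpoly"
  assume "f \<otimes>\<^bsub>S\<^esub> g \<in> ?P"
  then have fg: "f * g \<in> ?P"
    by simp
  obtain f' where f': "Poly_Mapping.keys f' = Poly_Mapping.keys f - W" "f - f' \<in> ?P"
    by (rule reduce_modulo_monomial_span)
  obtain g' where g': "Poly_Mapping.keys g' = Poly_Mapping.keys g - W" "g - g' \<in> ?P"
    by (rule reduce_modulo_monomial_span)
  have "f' = 0 \<or> g' = 0"
  proof (rule ccontr)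
    assume "\<not> ?thesis"
    then obtain a b where ab: "a \<in> Poly_Mapping.keys f'" "b \<in> Poly_Mapping.keys g'"
      "a + b \<in> Poly_Mapping.keys (f' * g')"
      using unique_key_of_mult[of f' g'] by blast
    have "f * (g - g') \<in> ?P" "g' * (f - f') \<in> ?P"
      using P f' g' unfolding ideal_S_iff by blast+
    then have "f * g - f * (g - g') - g' * (f - f') \<in> ?P"
      using fg by (intro ideal_minus_mem[OF P])
    moreover have "f * g - f * (g - g') - g' * (f - f') = f' * g'"
      by (simp add: algebra_simps)
    ultimately have "a + b \<in> W"
      using ab by (auto simp: monomial_span_def)
    then show False
      using W(3) ab f' g' by blast
  qed
  then show "f \<in> ?P \<or> g \<in> ?P"
    using f' g' by auto
qed

text \<open>For a nonzero monomial ideal, a prime colon ideal contains a variable.\<close>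

lemma degree_bound_of_colon_prime:
  fixes f :: "('n::finite, 'k::field) mpoly"
  assumes U: "upset U" "U \<noteq> {}" and D: "\<And>u. u \<in> U \<Longrightarrow> D \<le> exp_degree u"
    and f: "f \<in> graded_part d" and P: "primeideal (colon S (monomial_span U) f) S"
  shows "D \<le> d + 1"
proof -
  let ?P = "colon S (monomial_span U) f"
  have I: "ideal (monomial_span U :: ('n, 'k) mpoly set) S"
    by (rule ideal_monomial_span[OF U(1)])
  obtain u where u: "u \<in> U"
    using U by blast
  have "mon u \<in> ?P"
  proof -
    have "f * mon u \<in> monomial_span U"
      using I u unfolding ideal_S_iff by (meson mon_mem_monomial_span_iff)
    then show ?thesis
      by (simp add: mult.commute)
  qed
  \<comment> \<open>Split off variables from the monomial until one of them lies in the prime ideal.\<close>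
  then have "\<exists>i. mon (Poly_Mapping.single i 1) \<in> ?P"
  proof (induction "exp_degree u" arbitrary: u)
    case 0
    then have "u = 0"
      by (intro poly_mapping_eqI) (simp add: exp_degree_def)
    then have "1 \<in> ?P"
      using 0 by simp
    then show ?case
      using primeideal_S_D(3)[OF P] by blast
  next
    case (Suc n)
    then obtain i where i: "Poly_Mapping.lookup u i \<noteq> 0"
      by (metis exp_degree_def sum.neutral nat.distinct(1))
    let ?e = "Poly_Mapping.single i 1 :: 'n \<Rightarrow>\<^sub>0 nat"
    have u: "u = ?e + (u - ?e)"
      using i by (intro poly_mapping_eqI) (auto simp: lookup_add lookup_minus lookup_single when_def)
    then have "exp_degree u = 1 + exp_degree (u - ?e)"
      by (metis exp_degree_add exp_degree_single)
    then have n: "n = exp_degree (u - ?e)"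
      using Suc.hyps by simp
    have "mon ?e * mon (u - ?e) \<in> ?P"
      using Suc.prems u by (metis mon_add)
    then have "mon ?e \<in> ?P \<or> mon (u - ?e) \<in> ?P"
      by (rule primeideal_S_D(4)[OF P])
    then show ?case
      using Suc.hyps(1)[OF n] by blast
  qed
  then obtain i where i: "mon (Poly_Mapping.single i 1) * f \<in> monomial_span U"
    by auto
  have "f \<noteq> 0"
  proof
    assume "f = 0"
    then have "1 \<in> ?P"
      by (simp add: monomial_span_def)
    then show False
      using primeideal_S_D(3)[OF P] by blast
  qed
  then obtain m where m: "m \<in> Poly_Mapping.keys f"
    by (metis all_not_in_conv keys_eq_empty)
  then have "Poly_Mapping.single i 1 + m \<in> U"
    using i by (auto simp: monomial_span_def keys_mon_mult)
  then have "D \<le> exp_degree (Poly_Mapping.single i 1 + m)"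
    by (rule D)
  then show ?thesis
    using m f by (simp add: exp_degree_add graded_part_def)
qed


section \<open>Associated primes of monomial ideals\<close>

lemma colon_prime_eq_colon_monomial:
  fixes f :: "('n::finite, 'k::field) mpoly"
  assumes U: "upset U" and P: "primeideal P S" and f: "P = colon S (monomial_span U) f"
  shows "\<exists>a. P = colon S (monomial_span U) (mon a)"
proof -
  let ?I = "monomial_span U :: ('n, 'k) mpoly set"
  have I: "ideal ?I S"
    by (rule ideal_monomial_span[OF U])
  let ?c = "\<lambda>f :: ('n, 'k) mpoly. card (Poly_Mapping.keys f - U)"
  obtain f0 where f0: "P = colon S ?I f0" and "\<forall>g. P = colon S ?I g \<longrightarrow> ?c f0 \<le> ?c g"
    using ex_has_least_nat[of "\<lambda>f. P = colon S ?I f" f ?c] f by blast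
  moreover obtain h where h: "Poly_Mapping.keys h = Poly_Mapping.keys f0 - U" "f0 - h \<in> ?I"
    by (rule reduce_modulo_monomial_span)
  ultimately have min: "card (Poly_Mapping.keys h) \<le> ?c g" if "P = colon S ?I g" for g
    using that by simp
  have Ph: "P = colon S ?I h"
    using f0 colon_cong[OF I h(2)] by simp
  \<comment> \<open>Multiplying \<open>h\<close> by a monomial outside \<open>P\<close> preserves the colon ideal and cannot move a term
    into the ideal, by minimality of \<open>h\<close>.\<close>
  have mem: "mon b \<in> P" if a: "a \<in> Poly_Mapping.keys h" "a + b \<in> U" for a b
  proof (rule ccontr)
    assume b: "mon b \<notin> P"
    have "P = colon S ?I (mon b * h)"
    proof (intro Set.set_eqI iffI)
      fix g assume "g \<in> P"
      then have "mon b * (g * h) \<in> ?I"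
        using Ph I unfolding ideal_S_iff by simp
      then show "g \<in> colon S ?I (mon b * h)"
        by (simp add: mult_ac)
    next
      fix g assume "g \<in> colon S ?I (mon b * h)"
      then have "g * mon b \<in> P"
        using Ph by (simp add: mult_ac)
      then show "g \<in> P"
        using primeideal_S_D(4)[OF P] b by blast
    qed
    then have "card (Poly_Mapping.keys h) \<le> ?c (mon b * h)"
      by (rule min)
    also have "\<dots> \<le> card ((+) b ` (Poly_Mapping.keys h - {a}))"
      using a by (intro card_mono) (auto simp: keys_mon_mult add.commute)
    also have "\<dots> \<le> card (Poly_Mapping.keys h - {a})"
      by (rule card_image_le) simp
    also have "\<dots> < card (Poly_Mapping.keys h)"
      using a by (intro psubset_card_mono) auto
    finally show False
      by simp
  qed
  have mem': "a + b \<in> U" if "a \<in> Poly_Mapping.keys h" "mon b \<in> P" for a b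
  proof -
    have "mon b * h \<in> ?I"
      using that Ph by simp
    then show ?thesis
      using that by (auto simp: monomial_span_def keys_mon_mult add.commute)
  qed
  have h0: "h \<noteq> 0"
  proof
    assume "h = 0"
    then have "1 \<in> P"
      unfolding Ph by (simp add: monomial_span_def)
    then show False
      using primeideal_S_D(3)[OF P] by blast
  qed
  then obtain a where a: "a \<in> Poly_Mapping.keys h"
    by (metis all_not_in_conv keys_eq_empty)
  have "P = monomial_span {b. a + b \<in> U}"
  proof
    show sub: "monomial_span {b. a + b \<in> U} \<subseteq> P"
    proof
      fix g :: "('n, 'k) mpoly"
      assume "g \<in> monomial_span {b. a + b \<in> U}"
      then have "\<forall>b\<in>Poly_Mapping.keys g. mon b \<in> P"
        using mem[OF a] unfolding monomial_span_def by blast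
      then show "g \<in> P"
        by (rule ideal_mem_if_monomials_mem[OF primeideal_S_D(1)[OF P]])
    qed
    show "P \<subseteq> monomial_span {b. a + b \<in> U}"
    proof
      fix g assume g: "g \<in> P"
      obtain g' where g': "Poly_Mapping.keys g' = Poly_Mapping.keys g - {b. a + b \<in> U}"
        "g - g' \<in> monomial_span {b. a + b \<in> U}"
        by (rule reduce_modulo_monomial_span)
      have "g - (g - g') \<in> P"
        by (rule ideal_minus_mem[OF primeideal_S_D(1)[OF P] g subsetD[OF sub g'(2)]])
      then have "g' * h \<in> ?I"
        using Ph by simp
      have "g' = 0"
      proof (rule ccontr)
        assume "g' \<noteq> 0"
        then obtain b c where bc: "b \<in> Poly_Mapping.keys g'" "c \<in> Poly_Mapping.keys h"
          "b + c \<in> Poly_Mapping.keys (g' * h)"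
          using unique_key_of_mult[of g' h] h0 by blast
        then have "c + b \<in> U"
          using \<open>g' * h \<in> ?I\<close> by (auto simp: monomial_span_def add.commute)
        then have "a + b \<in> U"
          using mem[OF bc(2)] mem'[OF a] by blast
        then show False
          using bc(1) g'(1) by blast
      qed
      then show "g \<in> monomial_span {b. a + b \<in> U}"
        using g'(2) by simp
    qed
  qed
  then show ?thesis
    unfolding colon_monomial_span_mon by blast
qed

text \<open>The combinatorial form of the existence of associated primes: the displayed set consists
  of the exponents of the monomials divisible by a variable with index outside \<open>B\<close>.\<close>

lemma upset_colon_coordinate_prime:
  fixes U :: "('n::finite \<Rightarrow>\<^sub>0 nat) set"
  assumes U: "upset U" "0 \<notin> U"
  shows "\<exists>a B. {b. a + b \<in> U} = {b. \<exists>i. i \<notin> B \<and> Poly_Mapping.lookup b i \<noteq> 0}"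
proof -
  \<comment> \<open>\<open>free B a\<close>: the translate of \<open>\<nat>\<^sup>B\<close> by \<open>a\<close> avoids \<open>U\<close>.\<close>
  define free :: "'n set \<Rightarrow> ('n \<Rightarrow>\<^sub>0 nat) \<Rightarrow> bool" where
    "free B a \<longleftrightarrow> (\<forall>b. (\<forall>i. i \<notin> B \<longrightarrow> Poly_Mapping.lookup b i = 0) \<longrightarrow> a + b \<notin> U)" for B a
  let ?e = "\<lambda>i n. Poly_Mapping.single i n :: 'n \<Rightarrow>\<^sub>0 nat"
  have "free {} 0"
  proof -
    have "b = 0" if "\<forall>i. Poly_Mapping.lookup b i = 0" for b :: "'n \<Rightarrow>\<^sub>0 nat"
      using that by (intro poly_mapping_eqI) simp
    then show ?thesis
      unfolding free_def using U(2) by auto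
  qed
  then have "\<exists>a. free {} a"
    by blast
  moreover have "\<forall>B. (\<exists>a. free B a) \<longrightarrow> card B \<le> card (UNIV :: 'n set)"
    by (simp add: card_mono)
  ultimately have "\<exists>B. (\<exists>a. free B a) \<and> (\<forall>C. (\<exists>a. free C a) \<longrightarrow> card C \<le> card B)"
    using ex_has_greatest_nat[of "\<lambda>B. \<exists>a. free B a"] by (metis le_imp_less_Suc)
  then obtain B a0 where a0: "free B a0" and max: "\<And>C a. free C a \<Longrightarrow> card C \<le> card B"
    by blast
  \<comment> \<open>Increase the coordinates outside \<open>B\<close> one after the other, each as far as freeness allows.\<close>
  have "\<exists>a. free B a \<and> (\<forall>i\<in>J. \<not> free B (a + ?e i 1))" if "finite J" "J \<subseteq> - B" for J
    using that
  proof (induction J rule: finite_induct)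
    case empty
    then show ?case using a0 by auto
  next
    case (insert j J)
    then obtain a where a: "free B a" "\<forall>i\<in>J. \<not> free B (a + ?e i 1)"
      by auto
    have "\<exists>n. \<not> free B (a + ?e j n)"
    proof (rule ccontr)
      assume "\<not> ?thesis"
      then have fr: "free B (a + ?e j n)" for n
        by blast
      have "free (insert j B) a"
        unfolding free_def
      proof (intro allI impI)
        fix b :: "'n \<Rightarrow>\<^sub>0 nat"
        assume b: "\<forall>i. i \<notin> insert j B \<longrightarrow> Poly_Mapping.lookup b i = 0"
        let ?n = "Poly_Mapping.lookup b j"
        have eq: "b = ?e j ?n + (b - ?e j ?n)"
          by (intro poly_mapping_eqI) (auto simp: lookup_add lookup_minus lookup_single when_def)
        have "\<forall>i. i \<notin> B \<longrightarrow> Poly_Mapping.lookup (b - ?e j ?n) i = 0"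
          using b by (auto simp: lookup_minus lookup_single when_def)
        then have "a + ?e j ?n + (b - ?e j ?n) \<notin> U"
          using fr[of ?n] unfolding free_def by blast
        then show "a + b \<notin> U"
          using eq by (metis add.assoc)
      qed
      then have "card (insert j B) \<le> card B"
        by (rule max)
      moreover have "j \<notin> B"
        using insert.prems by auto
      ultimately show False
        by simp
    qed
    then obtain n where n: "\<not> free B (a + ?e j n)" "\<And>m. m < n \<Longrightarrow> free B (a + ?e j m)"
      using exists_least_iff[of "\<lambda>n. \<not> free B (a + ?e j n)"] by blast
    have "n \<noteq> 0"
      using n(1) a(1) by (metis single_zero add.right_neutral)
    then obtain m where m: "n = Suc m"
      by (metis nat.exhaust)
    have "free B (a + ?e j m)"
      using n(2) m by simp
    moreover have "\<not> free B (a + ?e j m + ?e j 1)"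
      using n(1) m by (simp add: add.assoc single_add[symmetric])
    moreover have "\<not> free B (a + ?e j m + ?e i 1)" if "i \<in> J" for i
    proof -
      obtain b where b: "\<forall>i. i \<notin> B \<longrightarrow> Poly_Mapping.lookup b i = 0" "a + ?e i 1 + b \<in> U"
        using a(2) \<open>i \<in> J\<close> unfolding free_def by blast
      have "a + ?e j m + ?e i 1 + b \<in> U"
        using upset_addD[OF U(1) b(2), of "?e j m"] by (simp add: add_ac)
      then show ?thesis
        unfolding free_def using b(1) by blast
    qed
    ultimately show ?case
      by (intro exI[of _ "a + ?e j m"]) auto
  qed
  from this[of "- B"] obtain a where a: "free B a" "\<forall>i\<in>- B. \<not> free B (a + ?e i 1)"
    by auto
  then have "\<forall>i\<in>- B. \<exists>b. (\<forall>l. l \<notin> B \<longrightarrow> Poly_Mapping.lookup b l = 0) \<and> a + ?e i 1 + b \<in> U"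
    unfolding free_def by blast
  then obtain w where w: "\<And>i l. i \<notin> B \<Longrightarrow> l \<notin> B \<Longrightarrow> Poly_Mapping.lookup (w i) l = 0"
    "\<And>i. i \<notin> B \<Longrightarrow> a + ?e i 1 + w i \<in> U"
    by (metis ComplI)
  \<comment> \<open>A common translation in the directions of \<open>B\<close> that works for all \<open>i \<notin> B\<close> at once.\<close>
  define s where "s = (\<Sum>i\<in>- B. w i)"
  have s: "Poly_Mapping.lookup s l = (\<Sum>i\<in>- B. Poly_Mapping.lookup (w i) l)" for l
    unfolding s_def by (simp add: lookup_sum)
  have "a + s + b \<in> U \<longleftrightarrow> (\<exists>i. i \<notin> B \<and> Poly_Mapping.lookup b i \<noteq> 0)" for b
  proof
    assume "a + s + b \<in> U"
    then have "\<not> (\<forall>i. i \<notin> B \<longrightarrow> Poly_Mapping.lookup (s + b) i = 0)"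
      using a(1) unfolding free_def by (metis add.assoc)
    then show "\<exists>i. i \<notin> B \<and> Poly_Mapping.lookup b i \<noteq> 0"
      using w(1) by (auto simp: lookup_add s)
  next
    assume "\<exists>i. i \<notin> B \<and> Poly_Mapping.lookup b i \<noteq> 0"
    then obtain i where i: "i \<notin> B" "Poly_Mapping.lookup b i \<noteq> 0"
      by blast
    show "a + s + b \<in> U"
    proof (rule upset_mono[OF U(1) w(2)[OF i(1)]])
      fix l
      have "Poly_Mapping.lookup (w i) l \<le> Poly_Mapping.lookup s l"
        unfolding s using i(1) by (intro member_le_sum) auto
      moreover have "Poly_Mapping.lookup (?e i 1) l \<le> Poly_Mapping.lookup b l"
        using i(2) by (auto simp: lookup_single when_def)
      ultimately show "Poly_Mapping.lookup (a + ?e i 1 + w i) l \<le> Poly_Mapping.lookup (a + s + b) l"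
        by (simp add: lookup_add)
    qed
  qed
  then show ?thesis
    by (intro exI[of _ "a + s"] exI[of _ B]) blast
qed

lemma exists_colon_monomial_in_Ass:
  assumes U: "upset U" "0 \<notin> U"
  shows "\<exists>a. colon S (monomial_span U) (mon a)
    \<in> Ass S (monomial_span U :: ('n::finite, 'k::field) mpoly set)"
proof -
  obtain a B where aB: "{b. a + b \<in> U} = {b. \<exists>i. i \<notin> B \<and> Poly_Mapping.lookup b i \<noteq> 0}"
    using upset_colon_coordinate_prime[OF U] by blast
  have "primeideal (monomial_span {b. a + b \<in> U} :: ('n, 'k) mpoly set) S"
    unfolding aB by (rule primeideal_monomial_span) (auto simp: upset_def lookup_add)
  then have "colon S (monomial_span U) (mon a) \<in> Ass S (monomial_span U :: ('n, 'k) mpoly set)"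
    unfolding Ass_eq_colon[OF ideal_monomial_span[OF U(1)]]
    using colon_monomial_span_mon[of U a, where 'k = 'k] by auto
  then show ?thesis
    by blast
qed


section \<open>Lower bounds for the v-numbers\<close>

lemma mon_mem_graded_part: "mon a \<in> graded_part (exp_degree a)"
  by (simp add: graded_part_def)

lemma v_number_at_lower_bound:
  fixes P :: "('n::finite, 'k::field) mpoly set"
  assumes U: "upset U" "U \<noteq> {}" and D: "\<And>u. u \<in> U \<Longrightarrow> D \<le> exp_degree u"
    and P: "P \<in> Ass S (monomial_span U)"
  shows "D \<le> v_number_at (monomial_span U) P + 1"
proof -
  have prime: "primeideal P S" and "\<exists>f. P = colon S (monomial_span U) f"
    using P unfolding Ass_eq_colon[OF ideal_monomial_span[OF U(1)]] by auto
  then obtain a where "colon S (monomial_span U) (mon a) = P"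
    using colon_prime_eq_colon_monomial[OF U(1) prime] by blast
  then have "\<exists>d. \<exists>f\<in>graded_part d. colon S (monomial_span U) f = P"
    using mon_mem_graded_part by blast
  from LeastI_ex[OF this] obtain f
    where "f \<in> graded_part (v_number_at (monomial_span U) P)" "colon S (monomial_span U) f = P"
    unfolding v_number_at_def by blast
  then show ?thesis
    using degree_bound_of_colon_prime[OF U D] prime by blast
qed

lemma v_number_lower_bound:
  fixes U :: "('n::finite \<Rightarrow>\<^sub>0 nat) set"
  assumes U: "upset U" "U \<noteq> {}" "0 \<notin> U" and D: "\<And>u. u \<in> U \<Longrightarrow> D \<le> exp_degree u"
  shows "D \<le> v_number (monomial_span U :: ('n, 'k::field) mpoly set) + 1"
proof -
  let ?I = "monomial_span U :: ('n, 'k) mpoly set"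
  have "\<exists>d. \<exists>f\<in>graded_part d. colon S ?I f \<in> Ass S ?I"
    using exists_colon_monomial_in_Ass[OF U(1,3), where 'k = 'k] mon_mem_graded_part by blast
  from LeastI_ex[OF this] obtain f
    where f: "f \<in> graded_part (v_number ?I)" "colon S ?I f \<in> Ass S ?I"
    unfolding v_number_def by blast
  then have "primeideal (colon S ?I f) S"
    unfolding Ass_def by blast
  then show ?thesis
    using degree_bound_of_colon_prime[OF U(1,2) D f(1)] by blast
qed

theorem proposition2p2:
  fixes I :: "('n::finite, 'k::field) mpoly set"
  assumes "monomial_ideal I" and "I \<noteq> {0}" and "I \<noteq> carrier S"
  shows "(\<forall>P \<in> Ass S I. int (v_number_at I P) \<ge> int (initial_degree I) - 1) \<and>
    (\<forall>k::nat. k \<ge> 1 \<longrightarrow>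
       int (v_number (I [^]\<^bsub>ideals_set S\<^esub> k)) \<ge> int (initial_degree I) * int k - 1)"
proof -
  obtain U where U: "upset U" and I: "I = monomial_span U"
    using assms(1) by (rule monomial_idealE)
  have ne: "U \<noteq> {}"
    using assms(2) I by (auto simp: monomial_span_def)
  have "U = UNIV" if "0 \<in> U"
    using upset_addD[OF U that] by auto
  then have zero: "0 \<notin> U"
    using assms(3) I by (auto simp: monomial_span_def)
  have deg: "initial_degree I \<le> exp_degree u" if "u \<in> U" for u
    unfolding I using that by (rule initial_degree_le)
  show ?thesis
  proof (intro conjI ballI allI impI)
    fix P assume "P \<in> Ass S I"
    then have "initial_degree I \<le> v_number_at I P + 1"
      using v_number_at_lower_bound[OF U ne deg] I by blast
    then show "int (v_number_at I P) \<ge> int (initial_degree I) - 1"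
      by linarith
  next
    fix k :: nat
    assume "k \<ge> 1"
    then obtain V where V: "upset V" "V \<noteq> {}" "V \<subseteq> U"
      "\<forall>v\<in>V. initial_degree I * k \<le> exp_degree v" "I [^]\<^bsub>ideals_set S\<^esub> k = monomial_span V"
      using ideal_power_monomial_span[OF U ne deg, of k, where 'k = 'k] I by blast
    then have "initial_degree I * k \<le> v_number (I [^]\<^bsub>ideals_set S\<^esub> k) + 1"
      using v_number_lower_bound[of V "initial_degree I * k", where 'k = 'k] zero by auto
    then have "int (initial_degree I * k) \<le> int (v_number (I [^]\<^bsub>ideals_set S\<^esub> k)) + 1"
      by linarith
    then show "int (v_number (I [^]\<^bsub>ideals_set S\<^esub> k)) \<ge> int (initial_degree I) * int k - 1"
      by simp
  qed
qed

end
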